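(* (1) The category $\mathbf{SIF}_{\mathbf t}$ is a full reflective subcategory of $\mathbf{CIF}_{\mathbf t}$. (2) The categories $\mathbf{SIF}_{\mathbf t}$ and $\mathbf{CIF}_{\mathbf t}$ are equivalent.
   Context: A continuous information frame is a triple $\mathbb{A}=(A,(\mathrm{Con}_i)_{i\in A},(\vDash_i)_{i\in A})$ where $A$ is a set, each $\mathrm{Con}_i$ is a set of finite subsets of $A$, and $\vDash_i\subseteq\mathrm{Con}_i\times A$; write $iRj$ iff $\{i\}\in\mathrm{Con}_j$, and $X\vDash_i Y$ iff $X\vDash_i b$ for all $b\in Y$. Required, for all $i,j,a\in A$ and finite $X,Y\subseteq A$: (i) $\{i\}\in\mathrm{Con}_i$; (ii) if $Y\subseteq X\in\mathrm{Con}_i$ then $Y\in\mathrm{Con}_i$; (iii) if $X\in\mathrm{Con}_i$ and $X\vDash_i Y$ then $Y\in\mathrm{Con}_i$; (iv) if $X,Y\in\mathrm{Con}_i$, $X\subseteq Y$, $X\vDash_i a$ then $Y\vDash_i a$; (v) if $X\in\mathrm{Con}_i$, $X\vDash_i Y$, $Y\vDash_i a$ then $X\vDash_i a$; (vi) if $iRj$ then $\mathrm{Con}_i\subseteq\mathrm{Con}_j$; (vii) if $iRj$, $X\in\mathrm{Con}_i$, $X\vDash_i a$ then $X\vDash_j a$; (viii) if $X\vDash_i Y$ then there exist $e\in A$, $Z\in\mathrm{Con}_e$ with $X\vDash_i \{e\}\cup Z$ and $Z\vDash_e Y$. It is strong if for all $i$ and $X\in\mathrm{Con}_i$ with $X\neq\{i\}$,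 $\{i\}\vDash_i X$. A token $\mathbf t$ is a truth element if $\emptyset\vDash_i\mathbf t$ for all $i\in A$. An approximable family $\mathbb H=(H_i)_{i\in A}$ from $\mathbb A$ to $\mathbb A'$ is a family of relations $H_i\subseteq\mathrm{Con}_i\times A'$ (write $XH_iY$ iff $XH_ic$ for all $c\in Y$) such that for all $i,j\in A$, $X,X'\in\mathrm{Con}_i$, $b,k\in A'$, $Y\in\mathrm{Con}'_k$, finite $F\subseteq A'$: (a) $XH_i(\{k\}\cup Y)$ and $Y\vDash'_k b$ imply $XH_ib$; (b) $X\subseteq X'$ and $XH_ib$ imply $X'H_ib$; (c) $X\vDash_iX'$ and $X'H_ib$ imply $XH_ib$; (d) $iRj$ and $XH_ib$ imply $XH_jb$; (e) if $XH_iF$ there are $c\in A$, $e\in A'$, $U\in\mathrm{Con}_c$, $V\in\mathrm{Con}'_e$ with $X\vDash_i\{c\}\cup U$, $UH_c(\{e\}\cup V)$, $V\vDash'_eF$. If $\mathbb A,\mathbb A'$ have truth elements $\mathbf t,\mathbf t'$, $\mathbb H$ respects truth elements if $\emptyset H_{\mathbf t}\mathbf t'$. Composition of $\mathbb G:\mathbb A^{(1)}\to\mathbb A^{(2)}$ and $\mathbb H:\mathbb A^{(2)}\to\mathbb A^{(3)}$: $X(\mathbb G\circ\mathbb H)_ia$ iff there are $e\in A^{(2)}$, $V\in\mathrm{Con}^{(2)}_e$ with $XG_i(\{e\}\cup V)$ and $VH_ea$; identity is $(\vDash_i)_{i\in A}$. $\mathbf{CIF}_{\mathbf t}$ (resp.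 $\mathbf{SIF}_{\mathbf t}$) is the category of continuous (resp. strong continuous) information frames with truth elements and truth-element-respecting approximable families. *)

theory Defs
  imports Main
begin

section \<open>Categories\<close>

text \<open>
  Composition is written in diagrammatic order: \<open>cmp C a b c f g\<close> is the composite of
  \<open>f : a \<rightarrow> b\<close> followed by \<open>g : b \<rightarrow> c\<close>. It takes the three objects as arguments because a
  morphism need not determine its source and target: hom sets are not required to be disjoint.
  Objects are the elements of \<open>obj C\<close>; nothing is required of the operations elsewhere.
\<close>

record ('o, 'm) cat =
  obj :: "'o set"
  hom :: "'o \<Rightarrow> 'o \<Rightarrow> 'm set"
  ide :: "'o \<Rightarrow> 'm"
  cmp :: "'o \<Rightarrow> 'o \<Rightarrow> 'o \<Rightarrow> 'm \<Rightarrow> 'm \<Rightarrow> 'm"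

locale category =
  fixes C :: "('o, 'm) cat"
  assumes ide_hom: "a \<in> obj C \<Longrightarrow> ide C a \<in> hom C a a"
    and cmp_hom: "\<lbrakk>a \<in> obj C; b \<in> obj C; c \<in> obj C; f \<in> hom C a b; g \<in> hom C b c\<rbrakk>
      \<Longrightarrow> cmp C a b c f g \<in> hom C a c"
    and ide_left: "\<lbrakk>a \<in> obj C; b \<in> obj C; f \<in> hom C a b\<rbrakk> \<Longrightarrow> cmp C a a b (ide C a) f = f"
    and ide_right: "\<lbrakk>a \<in> obj C; b \<in> obj C; f \<in> hom C a b\<rbrakk> \<Longrightarrow> cmp C a b b f (ide C b) = f"
    and cmp_assoc: "\<lbrakk>a \<in> obj C; b \<in> obj C; c \<in> obj C; d \<in> obj C;
        f \<in> hom C a b; g \<in> hom C b c; h \<in> hom C c d\<rbrakk>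
      \<Longrightarrow> cmp C a c d (cmp C a b c f g) h = cmp C a b d f (cmp C b c d g h)"

record ('o, 'm, 'p, 'n) cat_functor =
  on_obj :: "'o \<Rightarrow> 'p"
  on_hom :: "'o \<Rightarrow> 'o \<Rightarrow> 'm \<Rightarrow> 'n"

locale is_functor = source: category C + target: category D
  for C :: "('o, 'm) cat" and D :: "('p, 'n) cat" +
  fixes F :: "('o, 'm, 'p, 'n) cat_functor"
  assumes on_obj: "a \<in> obj C \<Longrightarrow> on_obj F a \<in> obj D"
    and on_hom: "\<lbrakk>a \<in> obj C; b \<in> obj C; f \<in> hom C a b\<rbrakk>
      \<Longrightarrow> on_hom F a b f \<in> hom D (on_obj F a) (on_obj F b)"
    and preserves_ide: "a \<in> obj C \<Longrightarrow> on_hom F a a (ide C a) = ide D (on_obj F a)"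
    and preserves_cmp: "\<lbrakk>a \<in> obj C; b \<in> obj C; c \<in> obj C; f \<in> hom C a b; g \<in> hom C b c\<rbrakk>
      \<Longrightarrow> on_hom F a c (cmp C a b c f g) =
          cmp D (on_obj F a) (on_obj F b) (on_obj F c) (on_hom F a b f) (on_hom F b c g)"

definition identity_functor :: "('o, 'm, 'o, 'm) cat_functor" where
  "identity_functor = \<lparr>on_obj = (\<lambda>a. a), on_hom = (\<lambda>a b f. f)\<rparr>"

text \<open>\<open>functor_comp F G\<close> applies \<open>F\<close> first.\<close>

definition functor_comp ::
  "('o, 'm, 'p, 'n) cat_functor \<Rightarrow> ('p, 'n, 'q, 'k) cat_functor \<Rightarrow> ('o, 'm, 'q, 'k) cat_functor"
  where
  "functor_comp F G =
    \<lparr>on_obj = (\<lambda>a. on_obj G (on_obj F a)),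
     on_hom = (\<lambda>a b f. on_hom G (on_obj F a) (on_obj F b) (on_hom F a b f))\<rparr>"

definition is_iso :: "('o, 'm) cat \<Rightarrow> 'o \<Rightarrow> 'o \<Rightarrow> 'm \<Rightarrow> bool" where
  "is_iso C a b f \<longleftrightarrow> f \<in> hom C a b \<and>
    (\<exists>g\<in>hom C b a. cmp C a b a f g = ide C a \<and> cmp C b a b g f = ide C b)"

definition natural_transformation ::
  "('o, 'm) cat \<Rightarrow> ('p, 'n) cat \<Rightarrow> ('o, 'm, 'p, 'n) cat_functor \<Rightarrow> ('o, 'm, 'p, 'n) cat_functor
    \<Rightarrow> ('o \<Rightarrow> 'n) \<Rightarrow> bool" where
  "natural_transformation C D F G \<eta> \<longleftrightarrow>
    is_functor C D F \<and> is_functor C D G \<and>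
    (\<forall>a\<in>obj C. \<eta> a \<in> hom D (on_obj F a) (on_obj G a)) \<and>
    (\<forall>a\<in>obj C. \<forall>b\<in>obj C. \<forall>f\<in>hom C a b.
       cmp D (on_obj F a) (on_obj F b) (on_obj G b) (on_hom F a b f) (\<eta> b) =
       cmp D (on_obj F a) (on_obj G a) (on_obj G b) (\<eta> a) (on_hom G a b f))"

definition natural_isomorphism ::
  "('o, 'm) cat \<Rightarrow> ('p, 'n) cat \<Rightarrow> ('o, 'm, 'p, 'n) cat_functor \<Rightarrow> ('o, 'm, 'p, 'n) cat_functor
    \<Rightarrow> ('o \<Rightarrow> 'n) \<Rightarrow> bool" where
  "natural_isomorphism C D F G \<eta> \<longleftrightarrow>
    natural_transformation C D F G \<eta> \<and>
    (\<forall>a\<in>obj C. is_iso D (on_obj F a) (on_obj G a) (\<eta> a))"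

definition equivalent_categories :: "('o, 'm) cat \<Rightarrow> ('p, 'n) cat \<Rightarrow> bool" where
  "equivalent_categories C D \<longleftrightarrow>
    (\<exists>F G \<eta> \<epsilon>. is_functor C D F \<and> is_functor D C G \<and>
      natural_isomorphism C C identity_functor (functor_comp F G) \<eta> \<and>
      natural_isomorphism D D (functor_comp G F) identity_functor \<epsilon>)"

text \<open>
  \<open>F : C \<rightarrow> D\<close> is left adjoint to \<open>G : D \<rightarrow> C\<close> if there are bijections
  \<open>\<phi> c d\<close> from the morphisms \<open>F c \<rightarrow> d\<close> to the morphisms \<open>c \<rightarrow> G d\<close>, natural in \<open>c\<close> and \<open>d\<close>.
\<close>

definition left_adjoint ::
  "('o, 'm) cat \<Rightarrow> ('p, 'n) cat \<Rightarrow> ('o, 'm, 'p, 'n) cat_functor \<Rightarrow> ('p, 'n, 'o, 'm) cat_functor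
    \<Rightarrow> bool" where
  "left_adjoint C D F G \<longleftrightarrow>
    is_functor C D F \<and> is_functor D C G \<and>
    (\<exists>\<phi>. (\<forall>c\<in>obj C. \<forall>d\<in>obj D.
           bij_betw (\<phi> c d) (hom D (on_obj F c) d) (hom C c (on_obj G d))) \<and>
         (\<forall>c\<in>obj C. \<forall>c'\<in>obj C. \<forall>d\<in>obj D. \<forall>f\<in>hom C c' c. \<forall>g\<in>hom D (on_obj F c) d.
           \<phi> c' d (cmp D (on_obj F c') (on_obj F c) d (on_hom F c' c f) g) =
           cmp C c' c (on_obj G d) f (\<phi> c d g)) \<and>
         (\<forall>c\<in>obj C. \<forall>d\<in>obj D. \<forall>d'\<in>obj D. \<forall>g\<in>hom D (on_obj F c) d. \<forall>h\<in>hom D d d'.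
           \<phi> c d' (cmp D (on_obj F c) d d' g h) =
           cmp C c (on_obj G d) (on_obj G d') (\<phi> c d g) (on_hom G d d' h)))"

definition subcategory :: "('o, 'm) cat \<Rightarrow> ('o, 'm) cat \<Rightarrow> bool" where
  "subcategory S C \<longleftrightarrow>
    category S \<and> category C \<and> obj S \<subseteq> obj C \<and>
    (\<forall>a\<in>obj S. \<forall>b\<in>obj S. hom S a b \<subseteq> hom C a b) \<and>
    (\<forall>a\<in>obj S. ide S a = ide C a) \<and>
    (\<forall>a\<in>obj S. \<forall>b\<in>obj S. \<forall>c\<in>obj S. \<forall>f\<in>hom S a b. \<forall>g\<in>hom S b c.
       cmp S a b c f g = cmp C a b c f g)"

definition full_subcategory :: "('o, 'm) cat \<Rightarrow> ('o, 'm) cat \<Rightarrow> bool" where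
  "full_subcategory S C \<longleftrightarrow>
    subcategory S C \<and> (\<forall>a\<in>obj S. \<forall>b\<in>obj S. hom S a b = hom C a b)"

text \<open>Here \<open>identity_functor\<close>, taken as a functor from \<open>S\<close> to \<open>C\<close>, is the inclusion.\<close>

definition reflective_subcategory :: "('o, 'm) cat \<Rightarrow> ('o, 'm) cat \<Rightarrow> bool" where
  "reflective_subcategory S C \<longleftrightarrow>
    subcategory S C \<and> (\<exists>F. left_adjoint C S F identity_functor)"


section \<open>Continuous information frames\<close>

record 'a info_frame =
  tokens :: "'a set"
  Con :: "'a \<Rightarrow> 'a set set"
  entails :: "'a \<Rightarrow> 'a set \<Rightarrow> 'a \<Rightarrow> bool"

text \<open>The extension of a relation between sets and tokens to one between sets and sets.\<close>

definition to_all :: "('a set \<Rightarrow> 'b \<Rightarrow> bool) \<Rightarrow> 'a set \<Rightarrow> 'b set \<Rightarrow> bool" where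
  "to_all r X Y \<longleftrightarrow> (\<forall>b\<in>Y. r X b)"

definition acc :: "'a info_frame \<Rightarrow> 'a \<Rightarrow> 'a \<Rightarrow> bool" where
  "acc A i j \<longleftrightarrow> {i} \<in> Con A j"

text \<open>
  The families \<open>Con A\<close> and \<open>entails A\<close> are indexed by the tokens of \<open>A\<close>; they are required to be
  empty at all other indices, so that a frame is determined by its mathematical data.
  In \<open>interpolation\<close>, the requirement \<open>X \<in> Con A i\<close> matters when \<open>Y\<close> is empty, since then
  \<open>to_all (entails A i) X Y\<close> is vacuously true.
\<close>

locale continuous_information_frame =
  fixes A :: "'a info_frame"
  assumes Con_tokens: "X \<in> Con A i \<Longrightarrow> i \<in> tokens A \<and> finite X \<and> X \<subseteq> tokens A"
    and entails_tokens: "entails A i X a \<Longrightarrow> i \<in> tokens A \<and> X \<in> Con A i \<and> a \<in> tokens A"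
    and self_consistent: "i \<in> tokens A \<Longrightarrow> {i} \<in> Con A i"
    and Con_subset: "\<lbrakk>i \<in> tokens A; X \<in> Con A i; Y \<subseteq> X\<rbrakk> \<Longrightarrow> Y \<in> Con A i"
    and Con_entailed: "\<lbrakk>i \<in> tokens A; finite Y; Y \<subseteq> tokens A; X \<in> Con A i;
        to_all (entails A i) X Y\<rbrakk> \<Longrightarrow> Y \<in> Con A i"
    and entails_weaken: "\<lbrakk>i \<in> tokens A; X \<in> Con A i; Y \<in> Con A i; X \<subseteq> Y; entails A i X a\<rbrakk>
      \<Longrightarrow> entails A i Y a"
    and entails_cut: "\<lbrakk>i \<in> tokens A; X \<in> Con A i; finite Y; Y \<subseteq> tokens A;
        to_all (entails A i) X Y; entails A i Y a\<rbrakk> \<Longrightarrow> entails A i X a"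
    and Con_transfer: "\<lbrakk>i \<in> tokens A; j \<in> tokens A; acc A i j\<rbrakk> \<Longrightarrow> Con A i \<subseteq> Con A j"
    and entails_transfer: "\<lbrakk>i \<in> tokens A; j \<in> tokens A; acc A i j; X \<in> Con A i; entails A i X a\<rbrakk>
      \<Longrightarrow> entails A j X a"
    and interpolation: "\<lbrakk>i \<in> tokens A; X \<in> Con A i; finite Y; Y \<subseteq> tokens A;
        to_all (entails A i) X Y\<rbrakk>
      \<Longrightarrow> \<exists>e\<in>tokens A. \<exists>Z\<in>Con A e.
            to_all (entails A i) X ({e} \<union> Z) \<and> to_all (entails A e) Z Y"

definition strong :: "'a info_frame \<Rightarrow> bool" where
  "strong A \<longleftrightarrow>
    (\<forall>i\<in>tokens A. \<forall>X\<in>Con A i. X \<noteq> {i} \<longrightarrow> to_all (entails A i) {i} X)"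

definition truth_element :: "'a info_frame \<Rightarrow> 'a \<Rightarrow> bool" where
  "truth_element A t \<longleftrightarrow> t \<in> tokens A \<and> (\<forall>i\<in>tokens A. entails A i {} t)"

text \<open>As with frames, a family \<open>H\<close> indexed by the tokens of \<open>A\<close> is empty at all other indices.\<close>

locale approximable_family =
  source: continuous_information_frame A + target: continuous_information_frame B
  for A :: "'a info_frame" and B :: "'b info_frame" +
  fixes H :: "'a \<Rightarrow> 'a set \<Rightarrow> 'b \<Rightarrow> bool"
  assumes family_tokens: "H i X b \<Longrightarrow> i \<in> tokens A \<and> X \<in> Con A i \<and> b \<in> tokens B"
    and family_entails: "\<lbrakk>i \<in> tokens A; X \<in> Con A i; k \<in> tokens B; Y \<in> Con B k;
        to_all (H i) X ({k} \<union> Y); entails B k Y b\<rbrakk> \<Longrightarrow> H i X b"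
    and family_weaken: "\<lbrakk>i \<in> tokens A; X \<in> Con A i; X' \<in> Con A i; X \<subseteq> X'; H i X b\<rbrakk>
      \<Longrightarrow> H i X' b"
    and entails_family: "\<lbrakk>i \<in> tokens A; X \<in> Con A i; X' \<in> Con A i;
        to_all (entails A i) X X'; H i X' b\<rbrakk> \<Longrightarrow> H i X b"
    and family_transfer: "\<lbrakk>i \<in> tokens A; j \<in> tokens A; acc A i j; X \<in> Con A i; H i X b\<rbrakk>
      \<Longrightarrow> H j X b"
    and family_interpolation: "\<lbrakk>i \<in> tokens A; X \<in> Con A i; finite F; F \<subseteq> tokens B;
        to_all (H i) X F\<rbrakk>
      \<Longrightarrow> \<exists>c\<in>tokens A. \<exists>e\<in>tokens B. \<exists>U\<in>Con A c. \<exists>V\<in>Con B e.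
            to_all (entails A i) X ({c} \<union> U) \<and> to_all (H c) U ({e} \<union> V) \<and>
            to_all (entails B e) V F"

text \<open>
  A frame may have several truth elements. The condition below quantifies over all of them; by
  \<open>respects_truth_elements_iff\<close> it can be tested on any one choice.
\<close>

definition respects_truth_elements ::
  "'a info_frame \<Rightarrow> 'b info_frame \<Rightarrow> ('a \<Rightarrow> 'a set \<Rightarrow> 'b \<Rightarrow> bool) \<Rightarrow> bool" where
  "respects_truth_elements A B H \<longleftrightarrow>
    (\<forall>t t'. truth_element A t \<longrightarrow> truth_element B t' \<longrightarrow> H t {} t')"

lemma respects_truth_elements_iff:
  assumes "approximable_family A B H" "truth_element A t" "truth_element B t'"
  shows "respects_truth_elements A B H \<longleftrightarrow> H t {} t'"
proof
  show "respects_truth_elements A B H \<Longrightarrow> H t {} t'"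
    using assms by (simp add: respects_truth_elements_def)
next
  interpret approximable_family A B H by fact
  assume H: "H t {} t'"
  have t: "t \<in> tokens A" "t' \<in> tokens B"
    using assms by (auto simp: truth_element_def)
  show "respects_truth_elements A B H"
    unfolding respects_truth_elements_def
  proof (intro allI impI)
    fix s s' assume s: "truth_element A s" "truth_element B s'"
    have "s \<in> tokens A" "entails A s {} t" "entails B t' {} s'"
      using s assms t by (auto simp: truth_element_def)
    then have "acc A t s"
      using source.Con_entailed[of s "{t}" "{}"] source.entails_tokens t
      by (auto simp: acc_def to_all_def)
    then have "H s {} t'"
      using family_transfer H family_tokens[OF H] \<open>s \<in> tokens A\<close> by blast
    then show "H s {} s'"
      using family_entails[of s "{}" t' "{}" s'] \<open>entails B t' {} s'\<close>
        family_tokens[of s "{}" t'] target.entails_tokens[of t' "{}" s']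
      by (simp add: to_all_def)
  qed
qed

text \<open>
  The composite of \<open>G\<close> followed by \<open>H\<close>, where \<open>B\<close> is the frame in the middle.
\<close>

definition family_comp ::
  "'b info_frame \<Rightarrow> ('a \<Rightarrow> 'a set \<Rightarrow> 'b \<Rightarrow> bool) \<Rightarrow> ('b \<Rightarrow> 'b set \<Rightarrow> 'c \<Rightarrow> bool)
    \<Rightarrow> 'a \<Rightarrow> 'a set \<Rightarrow> 'c \<Rightarrow> bool" where
  "family_comp B G H = (\<lambda>i X a.
    \<exists>e\<in>tokens B. \<exists>V\<in>Con B e. to_all (G i) X ({e} \<union> V) \<and> H e V a)"

text \<open>
  HOL has no type of all sets, so the tokens of the frames are drawn from a fixed but arbitrary
  type \<open>'a\<close>, which plays the role of the universe. It should be infinite for the universe to be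
  closed, up to bijection, under forming pairs and finite subsets; single frames may be finite.
\<close>

type_synonym 'a family = "'a \<Rightarrow> 'a set \<Rightarrow> 'a \<Rightarrow> bool"

definition CIF_t :: "('a info_frame, 'a family) cat" where
  "CIF_t =
    \<lparr>obj = {A. continuous_information_frame A \<and> (\<exists>t. truth_element A t)},
     hom = (\<lambda>A B. {H. approximable_family A B H \<and> respects_truth_elements A B H}),
     ide = entails,
     cmp = (\<lambda>A B C. family_comp B)\<rparr>"

definition SIF_t :: "('a info_frame, 'a family) cat" where
  "SIF_t =
    \<lparr>obj = {A. continuous_information_frame A \<and> strong A \<and> (\<exists>t. truth_element A t)},
     hom = (\<lambda>A B. {H. approximable_family A B H \<and> respects_truth_elements A B H}),
     ide = entails,
     cmp = (\<lambda>A B C. family_comp B)\<rparr>"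

end

theory Submission
  imports Defs
begin

text \<open>
  Every frame \<open>A\<close> is isomorphic to a strong one. The pairs \<open>(i, X)\<close> with \<open>X \<in> Con A i\<close>, ordered by
  \<open>(j, Y) \<prec> (i, X)\<close> iff \<open>X\<close> entails \<open>{j} \<union> Y\<close> at \<open>i\<close>, form an abstract basis, and an abstract basis
  becomes a strong frame if every set consistent at \<open>b\<close> entails at \<open>b\<close> exactly the elements below
  \<open>b\<close>. Since the universe is infinite, the pairs can be coded by its elements. The rest is formal: a
  full subcategory meeting every isomorphism class is reflective and equivalent to the whole
  category.
\<close>

unbundle cardinal_syntax

lemma to_all_insert [simp]: "to_all r X (insert b Y) \<longleftrightarrow> r X b \<and> to_all r X Y"
  by (simp add: to_all_def)

lemma to_all_empty [simp]: "to_all r X {}"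
  by (simp add: to_all_def)

lemma to_all_Un [simp]: "to_all r X (Y \<union> Z) \<longleftrightarrow> to_all r X Y \<and> to_all r X Z"
  by (auto simp: to_all_def)

lemma to_all_UN [simp]: "to_all r X (\<Union>i\<in>I. Y i) \<longleftrightarrow> (\<forall>i\<in>I. to_all r X (Y i))"
  by (auto simp: to_all_def)


section \<open>Full subcategories meeting every isomorphism class\<close>

lemma category_full_sub:
  assumes "category C" "obj S \<subseteq> obj C" "hom S = hom C" "ide S = ide C" "cmp S = cmp C"
  shows "full_subcategory S C"
proof -
  interpret category C by fact
  have "category S"
    using assms(2-) ide_hom cmp_hom ide_left ide_right cmp_assoc
    by unfold_locales (auto simp: subset_iff)
  then show ?thesis
    using assms by (auto simp: full_subcategory_def subcategory_def)
qed

text \<open>A bare choice of isomorphic objects suffices: conjugating arrows by the isomorphisms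
  makes \<open>r\<close> a functor and \<open>\<eta>\<close>, \<open>\<epsilon>\<close>
  natural.\<close>

locale isomorphic_replacement = category C for C :: "('o, 'm) cat" +
  fixes S :: "('o, 'm) cat" and r :: "'o \<Rightarrow> 'o" and \<eta> \<epsilon> :: "'o \<Rightarrow> 'm"
  assumes full: "full_subcategory S C"
    and r_obj: "a \<in> obj C \<Longrightarrow> r a \<in> obj S"
    and \<eta>_hom: "a \<in> obj C \<Longrightarrow> \<eta> a \<in> hom C a (r a)"
    and \<epsilon>_hom: "a \<in> obj C \<Longrightarrow> \<epsilon> a \<in> hom C (r a) a"
    and \<eta>_\<epsilon>: "a \<in> obj C \<Longrightarrow> cmp C a (r a) a (\<eta> a) (\<epsilon> a) = ide C a"
    and \<epsilon>_\<eta>: "a \<in> obj C \<Longrightarrow> cmp C (r a) a (r a) (\<epsilon> a) (\<eta> a) = ide C (r a)"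
begin

lemma S_cat: "category S"
  and S_obj: "a \<in> obj S \<Longrightarrow> a \<in> obj C"
  and S_hom: "a \<in> obj S \<Longrightarrow> b \<in> obj S \<Longrightarrow> hom S a b = hom C a b"
  and S_ide: "a \<in> obj S \<Longrightarrow> ide S a = ide C a"
  and S_cmp: "\<lbrakk>a \<in> obj S; b \<in> obj S; c \<in> obj S; f \<in> hom C a b; g \<in> hom C b c\<rbrakk>
    \<Longrightarrow> cmp S a b c f g = cmp C a b c f g"
  using full by (auto simp: full_subcategory_def subcategory_def)

lemma r_obj': "a \<in> obj C \<Longrightarrow> r a \<in> obj C"
  by (simp add: r_obj S_obj)

text \<open>Rewriting with \<open>cmp_assoc\<close> nests composites to the right, which can hide
  \<open>\<eta> a\<close> followed by \<open>\<epsilon> a\<close> in front of a third arrow. This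
  law and its mirror image cancel the pair there.\<close>

lemma \<eta>_\<epsilon>_cancel:
  assumes "a \<in> obj C" "x \<in> obj C" "g \<in> hom C a x"
  shows "cmp C a (r a) x (\<eta> a) (cmp C (r a) a x (\<epsilon> a) g) = g"
  using cmp_assoc[of a "r a" a x "\<eta> a" "\<epsilon> a" g] assms
  by (simp add: r_obj' \<eta>_hom \<epsilon>_hom \<eta>_\<epsilon> ide_left)

lemma \<epsilon>_\<eta>_cancel:
  assumes "a \<in> obj C" "x \<in> obj C" "g \<in> hom C (r a) x"
  shows "cmp C (r a) a x (\<epsilon> a) (cmp C a (r a) x (\<eta> a) g) = g"
  using cmp_assoc[of "r a" a "r a" x "\<epsilon> a" "\<eta> a" g] assms
  by (simp add: r_obj' \<eta>_hom \<epsilon>_hom \<epsilon>_\<eta> ide_left)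

lemmas arrow_simps = r_obj r_obj' S_obj S_hom S_ide S_cmp \<eta>_hom \<epsilon>_hom \<eta>_\<epsilon> \<epsilon>_\<eta> ide_hom cmp_hom
  ide_left ide_right cmp_assoc \<eta>_\<epsilon>_cancel \<epsilon>_\<eta>_cancel

text \<open>Transport of structure: arrows are conjugated, so the inner isomorphisms cancel in
  composites.\<close>

definition reflector :: "('o, 'm, 'o, 'm) cat_functor" where
  "reflector = \<lparr>on_obj = r,
    on_hom = (\<lambda>a b f. cmp C (r a) a (r b) (\<epsilon> a) (cmp C a b (r b) f (\<eta> b)))\<rparr>"

lemma reflector_simps [simp]:
  "on_obj reflector = r"
  "on_hom reflector a b f = cmp C (r a) a (r b) (\<epsilon> a) (cmp C a b (r b) f (\<eta> b))"
  by (simp_all add: reflector_def)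

lemma reflector_functor: "is_functor C S reflector"
proof -
  interpret S: category S by (rule S_cat)
  show ?thesis
    by unfold_locales (simp_all add: arrow_simps)
qed

lemma inclusion_functor: "is_functor S C identity_functor"
proof -
  interpret S: category S by (rule S_cat)
  show ?thesis
    by unfold_locales (simp_all add: arrow_simps identity_functor_def)
qed

text \<open>The unit is \<open>\<eta>\<close>: transposition is precomposition with
  \<open>\<eta> c\<close>, and precomposition with \<open>\<epsilon> c\<close> undoes it.\<close>

lemma left_adjoint_reflector: "left_adjoint C S reflector identity_functor"
proof -
  let ?\<phi> = "\<lambda>c d g. cmp C c (r c) d (\<eta> c) g"
  have "bij_betw (?\<phi> c d) (hom S (r c) d) (hom C c d)" if "c \<in> obj C" "d \<in> obj S" for c d
    by (rule bij_betw_byWitness[where f' = "\<lambda>f. cmp C (r c) c d (\<epsilon> c) f"])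
      (use that in \<open>auto simp: arrow_simps\<close>)
  then show ?thesis
    unfolding left_adjoint_def
    by (intro conjI reflector_functor inclusion_functor exI[of _ ?\<phi>])
      (simp_all add: arrow_simps identity_functor_def)
qed

lemma reflective: "reflective_subcategory S C"
  using full left_adjoint_reflector
  by (auto simp: reflective_subcategory_def full_subcategory_def)

text \<open>Inclusion and \<open>reflector\<close> are inverse to each other up to
  \<open>\<eta>\<close> and \<open>\<epsilon>\<close>. By fullness the inverse
  \<open>\<epsilon> a\<close> of \<open>\<eta> a\<close> is again an arrow of
  \<open>S\<close>.\<close>

lemma equivalent: "equivalent_categories S C"
proof -
  interpret S: category S by (rule S_cat)
  have "is_functor S S identity_functor" "is_functor C C identity_functor"
    by unfold_locales (simp_all add: identity_functor_def)
  moreover have "is_functor S S (functor_comp identity_functor reflector)"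
    "is_functor C C (functor_comp reflector identity_functor)"
    by unfold_locales (simp_all add: identity_functor_def functor_comp_def arrow_simps)
  moreover have "is_iso S a (r a) (\<eta> a)" if "a \<in> obj S" for a
    unfolding is_iso_def using that by (auto simp: arrow_simps intro!: bexI[of _ "\<epsilon> a"])
  moreover have "is_iso C (r a) a (\<epsilon> a)" if "a \<in> obj C" for a
    unfolding is_iso_def using that by (auto simp: arrow_simps intro!: bexI[of _ "\<eta> a"])
  ultimately have "natural_isomorphism S S identity_functor
      (functor_comp identity_functor reflector) \<eta>"
    "natural_isomorphism C C (functor_comp reflector identity_functor) identity_functor \<epsilon>"
    by (simp_all add: natural_isomorphism_def natural_transformation_def identity_functor_def
        functor_comp_def arrow_simps)
  then show ?thesis
    unfolding equivalent_categories_def using inclusion_functor reflector_functor by blast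
qed

end


section \<open>The category of frames with truth elements\<close>

context continuous_information_frame
begin

lemma to_all_tokens: "to_all (entails A i) X Y \<Longrightarrow> Y \<subseteq> tokens A"
  by (auto simp: to_all_def dest: entails_tokens)

lemma Con_finite: "X \<in> Con A i \<Longrightarrow> finite X"
  using Con_tokens by blast

lemma entails_acc: "entails A i X e \<Longrightarrow> acc A e i"
  using Con_entailed[of i "{e}" X] entails_tokens[of i X e] by (simp add: acc_def)

text \<open>Being entailed at \<open>i\<close>, the singleton \<open>{e}\<close> is consistent
  there. Hence the entailment of \<open>a\<close> by \<open>Z\<close> transfers from index
  \<open>e\<close> to index \<open>i\<close>, where the cut axiom applies.\<close>

lemma entails_through:
  assumes "entails A i X e" "to_all (entails A i) X Z" "entails A e Z a"
  shows "entails A i X a"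
proof -
  have "i \<in> tokens A" "e \<in> tokens A" "X \<in> Con A i" "Z \<in> Con A e"
    using assms entails_tokens by blast+
  then show ?thesis
    using assms entails_transfer[of e i Z a] entails_acc[of i X e]
      entails_cut[of i X Z a] Con_tokens[of Z e] by simp
qed

lemma to_all_entails_through:
  "\<lbrakk>entails A i X e; to_all (entails A i) X Z; to_all (entails A e) Z Y\<rbrakk>
    \<Longrightarrow> to_all (entails A i) X Y"
  using entails_through[of i X e Z] unfolding to_all_def by blast

lemma interpolate:
  assumes "X \<in> Con A i" "finite Y" "to_all (entails A i) X Y"
  obtains e Z where "entails A i X e" "Z \<in> Con A e" "to_all (entails A i) X Z"
    "to_all (entails A e) Z Y"
  using interpolation[of i X Y] assms Con_tokens[of X i] to_all_tokens by auto

lemma empty_Con: "i \<in> tokens A \<Longrightarrow> {} \<in> Con A i"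
  using self_consistent Con_subset by blast

lemma approximable_entails: "approximable_family A A (entails A)"
proof unfold_locales
  fix i X F
  assume "i \<in> tokens A" "X \<in> Con A i" "finite F" "F \<subseteq> tokens A" "to_all (entails A i) X F"
  then obtain e Z where e: "entails A i X e" "Z \<in> Con A e" "to_all (entails A i) X Z"
      "to_all (entails A e) Z F"
    using interpolate by blast
  \<comment> \<open>The axiom for families asks for two intermediate stages, so a second
    interpolation puts \<open>c\<close>, \<open>U\<close> between \<open>X\<close> and the whole
    first stage \<open>insert e Z\<close>.\<close>
  then obtain c U where c: "entails A i X c" "U \<in> Con A c" "to_all (entails A i) X U"
      "to_all (entails A c) U (insert e Z)"
    using interpolate[of X i "insert e Z"] \<open>X \<in> Con A i\<close> Con_finite[of Z e] by auto
  have "c \<in> tokens A" "e \<in> tokens A"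
    using c(1) e(1) entails_tokens by blast+
  with c e show "\<exists>c\<in>tokens A. \<exists>e\<in>tokens A. \<exists>U\<in>Con A c. \<exists>V\<in>Con A e.
      to_all (entails A i) X ({c} \<union> U) \<and> to_all (entails A c) U ({e} \<union> V) \<and>
      to_all (entails A e) V F"
    by (intro bexI[of _ c] bexI[of _ e] bexI[of _ U] bexI[of _ Z]) simp_all
next
  fix i X k Y b
  assume "to_all (entails A i) X ({k} \<union> Y)" "entails A k Y b"
  then show "entails A i X b"
    using entails_through[of i X k Y b] by simp
next
  fix i X X' b
  assume "i \<in> tokens A" "X \<in> Con A i" "X' \<in> Con A i" "to_all (entails A i) X X'"
    "entails A i X' b"
  then show "entails A i X b"
    using entails_cut[of i X X' b] Con_tokens[of X' i] by simp
next
  fix i j X b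
  assume "i \<in> tokens A" "j \<in> tokens A" "acc A i j" "X \<in> Con A i" "entails A i X b"
  then show "entails A j X b"
    by (rule entails_transfer)
qed (auto dest: entails_tokens intro: entails_weaken)

end

section \<open>Interpolation and unit laws for approximable families\<close>

context approximable_family
begin

lemma to_all_family_tokens: "to_all (H i) X F \<Longrightarrow> F \<subseteq> tokens B"
  by (auto simp: to_all_def dest: family_tokens)

lemma family_through:
  assumes "H i X k" "to_all (H i) X Y" "entails B k Y b"
  shows "H i X b"
  using assms family_entails[of i X k Y b] family_tokens[of i X k] target.entails_tokens[of k Y b]
  by simp

text \<open>The source-side counterpart of \<open>family_through\<close>: as \<open>{c}\<close> is
  consistent at \<open>i\<close>, both the consistency of \<open>U\<close> and the relation
  \<open>H c U b\<close> move to index \<open>i\<close>, where \<open>X\<close> can replace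
  \<open>U\<close>.\<close>

lemma entails_through_family:
  assumes "entails A i X c" "to_all (entails A i) X U" "H c U b"
  shows "H i X b"
proof -
  have t: "i \<in> tokens A" "X \<in> Con A i" "c \<in> tokens A" "U \<in> Con A c"
    using assms family_tokens source.entails_tokens by blast+
  have c: "acc A c i"
    using assms source.entails_acc by blast
  have "U \<in> Con A i"
    using source.Con_transfer[of c i] c t by blast
  then show ?thesis
    using entails_family[of i X U b] family_transfer[of c i U b] c t assms by simp
qed

lemma family_interpolate:
  assumes "X \<in> Con A i" "finite F" "to_all (H i) X F"
  obtains c U e V where "entails A i X c" "U \<in> Con A c" "to_all (entails A i) X U"
    "H c U e" "V \<in> Con B e" "to_all (H c) U V" "to_all (entails B e) V F"
  using family_interpolation[of i X F] assms source.Con_tokens[of X i] to_all_family_tokens[of i X F]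
  by auto

text \<open>Of the two stages of \<open>family_interpolate\<close> only the one in \<open>A\<close>
  is kept; \<open>e\<close>, \<open>V\<close> are absorbed by \<open>family_through\<close>. The
  right version absorbs \<open>c\<close>, \<open>U\<close> instead.\<close>

lemma family_interpolate_left:
  assumes "X \<in> Con A i" "finite F" "to_all (H i) X F"
  obtains c U where "entails A i X c" "U \<in> Con A c" "to_all (entails A i) X U" "to_all (H c) U F"
  using family_interpolate[OF assms] family_through unfolding to_all_def by metis

lemma family_interpolate_right:
  assumes "X \<in> Con A i" "finite F" "to_all (H i) X F"
  obtains e V where "H i X e" "V \<in> Con B e" "to_all (H i) X V" "to_all (entails B e) V F"
  using family_interpolate[OF assms] entails_through_family unfolding to_all_def by metis

lemma entails_family_comp: "family_comp A (entails A) H = H"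
proof (intro ext iffI)
  fix i X b
  assume "family_comp A (entails A) H i X b"
  then show "H i X b"
    by (auto simp: family_comp_def intro: entails_through_family)
next
  fix i X b
  assume "H i X b"
  then show "family_comp A (entails A) H i X b"
    using family_interpolate_left[of X i "{b}"] family_tokens source.entails_tokens
    by (simp add: family_comp_def) metis
qed

lemma family_comp_entails: "family_comp B H (entails B) = H"
proof (intro ext iffI)
  fix i X b
  assume "family_comp B H (entails B) i X b"
  then show "H i X b"
    by (auto simp: family_comp_def intro: family_through)
next
  fix i X b
  assume "H i X b"
  then show "family_comp B H (entails B) i X b"
    using family_interpolate_right[of X i "{b}"] family_tokens
    by (simp add: family_comp_def) metis
qed

end

section \<open>Composition of approximable families\<close>

locale composable = G: approximable_family A B G + H: approximable_family B C H
  for A :: "'a info_frame" and B :: "'b info_frame" and C :: "'c info_frame" and G H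
begin

text \<open>\<open>H e V a\<close> already forces \<open>e\<close> to be a token and
  \<open>V\<close> to be consistent at \<open>e\<close>.\<close>

lemma family_comp_iff: "family_comp B G H i X a \<longleftrightarrow>
    (\<exists>e V. G i X e \<and> to_all (G i) X V \<and> H e V a)"
  using H.family_tokens by (fastforce simp: family_comp_def)

text \<open>The witnesses for the single elements of \<open>F\<close> are collected by the interpolation property
  of \<open>G\<close>.\<close>

lemma to_all_family_comp:
  assumes "X \<in> Con A i" "finite F" "to_all (family_comp B G H i) X F"
  obtains e V where "G i X e" "V \<in> Con B e" "to_all (G i) X V" "to_all (H e) V F"
proof -
  have "\<forall>a\<in>F. \<exists>e V. G i X e \<and> to_all (G i) X V \<and> H e V a"
    using assms(3) by (simp add: to_all_def[of _ X F] family_comp_iff)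
  then obtain d D where d: "\<And>a. a \<in> F \<Longrightarrow> G i X (d a) \<and> to_all (G i) X (D a) \<and> H (d a) (D a) a"
    by metis
  have "to_all (G i) X (\<Union>a\<in>F. insert (d a) (D a))"
    using d by simp
  moreover have "finite (D a)" if "a \<in> F" for a
    using d[OF that] H.family_tokens[of "d a" "D a" a] G.target.Con_finite by blast
  then have "finite (\<Union>a\<in>F. insert (d a) (D a))"
    using \<open>finite F\<close> by simp
  ultimately obtain e V where e: "G i X e" "V \<in> Con B e" "to_all (G i) X V"
      and V: "to_all (entails B e) V (\<Union>a\<in>F. insert (d a) (D a))"
    using G.family_interpolate_right[OF \<open>X \<in> Con A i\<close>] by blast
  have "H e V a" if "a \<in> F" for a
    using d[OF that] H.entails_through_family V that by auto
  then show thesis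
    using that e by (simp add: to_all_def)
qed

lemma approximable_family_comp: "approximable_family A C (family_comp B G H)"
proof unfold_locales
  fix i X b
  assume "family_comp B G H i X b"
  then show "i \<in> tokens A \<and> X \<in> Con A i \<and> b \<in> tokens C"
    using G.family_tokens H.family_tokens by (auto simp: family_comp_iff)
next
  fix i X k Y b
  assume "X \<in> Con A i" "Y \<in> Con C k" "to_all (family_comp B G H i) X ({k} \<union> Y)"
    and b: "entails C k Y b"
  then obtain e V where "G i X e" "V \<in> Con B e" "to_all (G i) X V"
      "to_all (H e) V ({k} \<union> Y)"
    using to_all_family_comp[of X i "{k} \<union> Y"] H.target.Con_finite[of Y k] by auto
  then show "family_comp B G H i X b"
    using b H.family_through[of e V k Y b] by (auto simp: family_comp_iff)
next
  fix i X X' b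
  assume "i \<in> tokens A" "X \<in> Con A i" "X' \<in> Con A i" "X \<subseteq> X'" "family_comp B G H i X b"
  then show "family_comp B G H i X' b"
    using G.family_weaken[of i X X'] unfolding family_comp_iff to_all_def by blast
next
  fix i X X' b
  assume "i \<in> tokens A" "X \<in> Con A i" "X' \<in> Con A i" "to_all (entails A i) X X'"
    "family_comp B G H i X' b"
  then show "family_comp B G H i X b"
    using G.entails_family[of i X X'] unfolding family_comp_iff to_all_def[of "G i"] by blast
next
  fix i j X b
  assume "i \<in> tokens A" "j \<in> tokens A" "acc A i j" "X \<in> Con A i" "family_comp B G H i X b"
  then show "family_comp B G H j X b"
    using G.family_transfer[of i j X] unfolding family_comp_iff to_all_def by blast
next
  fix i X F
  assume X: "X \<in> Con A i" and F: "finite F" "to_all (family_comp B G H i) X F"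
  then obtain e V where e: "G i X e" "V \<in> Con B e" "to_all (G i) X V" "to_all (H e) V F"
    using to_all_family_comp by blast
  then obtain d W where d: "H e V d" "W \<in> Con C d" "to_all (H e) V W" "to_all (entails C d) W F"
    using H.family_interpolate_right F by metis
  \<comment> \<open>This completes the chain on the left: \<open>X\<close> entails \<open>c\<close>,
    \<open>U\<close>, then \<open>G\<close> leads to \<open>e\<close>, \<open>V\<close>, then
    \<open>H\<close> to \<open>d\<close>, \<open>W\<close>, which entail \<open>F\<close>.\<close>
  obtain c U where c: "entails A i X c" "U \<in> Con A c" "to_all (entails A i) X U"
      "to_all (G c) U (insert e V)"
    using G.family_interpolate_left[of X i "insert e V"] e X G.target.Con_finite[of V e] by auto
  have "to_all (family_comp B G H c) U (insert d W)"
    using c d by (fastforce simp: to_all_def[of "family_comp B G H c"] to_all_def[of "H e"] family_comp_iff)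
  then show "\<exists>c\<in>tokens A. \<exists>e\<in>tokens C. \<exists>U\<in>Con A c. \<exists>V\<in>Con C e.
      to_all (entails A i) X ({c} \<union> U) \<and> to_all (family_comp B G H c) U ({e} \<union> V) \<and>
      to_all (entails C e) V F"
    using c d G.source.entails_tokens[of i X c] H.family_tokens[of e V d]
    by (intro bexI[of _ c] bexI[of _ d] bexI[of _ U] bexI[of _ W]) simp_all
qed

lemma family_comp_truth:
  assumes "respects_truth_elements A B G" "respects_truth_elements B C H" "truth_element B t"
  shows "respects_truth_elements A C (family_comp B G H)"
  using assms unfolding respects_truth_elements_def family_comp_iff
  by (metis to_all_empty)

end

text \<open>From left to right, each element of \<open>insert e V\<close> comes with its own middle
  stage in \<open>B\<close>; \<open>to_all_family_comp\<close> merges them into one. The converse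
  reuses the given witnesses.\<close>

lemma family_comp_assoc:
  assumes "approximable_family A B F" "approximable_family B C G" "approximable_family C D H"
  shows "family_comp C (family_comp B F G) H = family_comp B F (family_comp C G H)"
proof -
  interpret FG: composable A B C F G
    using assms by (simp add: composable_def)
  interpret GH: composable B C D G H
    using assms by (simp add: composable_def)
  interpret FG_H: composable A C D "family_comp B F G" H
    using assms FG.approximable_family_comp by (simp add: composable_def)
  interpret F_GH: composable A B D F "family_comp C G H"
    using assms GH.approximable_family_comp by (simp add: composable_def)
  show ?thesis
  proof (intro ext iffI)
    fix i X a
    assume "family_comp C (family_comp B F G) H i X a"
    then obtain e V where e: "to_all (family_comp B F G i) X (insert e V)" "H e V a"
      by (auto simp: FG_H.family_comp_iff)
    have "X \<in> Con A i" "finite (insert e V)"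
      using e FG_H.G.family_tokens[of i X e] GH.H.family_tokens[of e V a]
        FG.H.target.Con_finite[of V e] by auto
    then obtain d W where "F i X d" "to_all (F i) X W" "to_all (G d) W (insert e V)"
      using e FG.to_all_family_comp[of X i "insert e V"] by metis
    then show "family_comp B F (family_comp C G H) i X a"
      using e by (auto simp: F_GH.family_comp_iff GH.family_comp_iff)
  next
    fix i X a
    assume "family_comp B F (family_comp C G H) i X a"
    then show "family_comp C (family_comp B F G) H i X a"
      unfolding F_GH.family_comp_iff GH.family_comp_iff FG_H.family_comp_iff
        to_all_def[of "family_comp B F G _"] to_all_def[of "G _"] FG.family_comp_iff by blast
  qed
qed

lemma category_CIF_t: "category CIF_t"
proof
  fix A B C :: "'a info_frame" and F G
  assume "A \<in> obj CIF_t" "B \<in> obj CIF_t" "C \<in> obj CIF_t" "F \<in> hom CIF_t A B" "G \<in> hom CIF_t B C"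
  then show "cmp CIF_t A B C F G \<in> hom CIF_t A C"
    using composable.approximable_family_comp[of A B C F G]
      composable.family_comp_truth[of A B C F G]
    by (auto simp: CIF_t_def composable_def)
qed (auto simp: CIF_t_def respects_truth_elements_def truth_element_def family_comp_assoc
    intro: continuous_information_frame.approximable_entails
      approximable_family.entails_family_comp approximable_family.family_comp_entails)


section \<open>Strong frames from pairs of an index and a consistent set\<close>

text \<open>
  A token \<open>b\<close> of the new frame stands for the pair \<open>(p b, q b)\<close> of an index and a set consistent
  for it; several tokens may stand for the same pair.
\<close>

locale pair_coding = continuous_information_frame A for A :: "'a info_frame" +
  fixes p :: "'b \<Rightarrow> 'a" and q :: "'b \<Rightarrow> 'a set"
  assumes code_ex: "finite X \<Longrightarrow> \<exists>b. p b = i \<and> q b = X"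
begin

definition codes :: "'b set" where
  "codes = {b. q b \<in> Con A (p b)}"

definition below :: "'b \<Rightarrow> 'b \<Rightarrow> bool" where
  "below a b \<longleftrightarrow> a \<in> codes \<and> entails A (p b) (q b) (p a) \<and> to_all (entails A (p b)) (q b) (q a)"

definition pair_Con :: "'b \<Rightarrow> 'b set set" where
  "pair_Con b = {Z. b \<in> codes \<and> finite Z \<and> (Z = {b} \<or> (\<forall>a\<in>Z. below a b))}"

text \<open>Entailment depends on the index only. In a strong frame every consistent set other than
  \<open>{b}\<close> follows from \<open>{b}\<close>, so the index already carries all the information.\<close>

definition pair_frame :: "'b info_frame" where
  "pair_frame = \<lparr>tokens = codes, Con = pair_Con, entails = (\<lambda>b Z a. Z \<in> pair_Con b \<and> below a b)\<rparr>"

lemma pair_frame_simps [simp]: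
  "tokens pair_frame = codes"
  "Con pair_frame = pair_Con"
  "entails pair_frame b Z a \<longleftrightarrow> Z \<in> pair_Con b \<and> below a b"
  by (simp_all add: pair_frame_def)

lemma to_all_pair_entails [simp]:
  "to_all (entails pair_frame b) Z Y \<longleftrightarrow> Y = {} \<or> Z \<in> pair_Con b \<and> (\<forall>a\<in>Y. below a b)"
  by (auto simp: to_all_def)

lemma code_obtain:
  assumes "X \<in> Con A i"
  obtains b where "p b = i" "q b = X" "b \<in> codes"
  using code_ex[of X i] Con_finite[OF assms] assms by (auto simp: codes_def)

lemma codes_Con: "b \<in> codes \<Longrightarrow> q b \<in> Con A (p b)"
  by (simp add: codes_def)

lemma codes_finite: "b \<in> codes \<Longrightarrow> finite (q b)"
  using codes_Con Con_finite by blast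

lemma below_codes: "below a b \<Longrightarrow> a \<in> codes \<and> b \<in> codes"
  using entails_tokens by (auto simp: below_def codes_def)

lemma below_entails: "below b c \<Longrightarrow> entails A (p b) (q b) x \<Longrightarrow> entails A (p c) (q c) x"
  using entails_through by (auto simp: below_def)

lemma below_trans: "below a b \<Longrightarrow> below b c \<Longrightarrow> below a c"
  using below_entails[of b c] by (auto simp: below_def[of a] to_all_def)

lemma acc_pair_frame: "acc pair_frame b c \<longleftrightarrow> c \<in> codes \<and> (b = c \<or> below b c)"
  by (auto simp: acc_def pair_Con_def)

text \<open>The index and the set that interpolate in \<open>A\<close> form a pair, and any code of
  this pair is the required token.\<close>

lemma below_interpolate:
  assumes "b \<in> codes" "finite Y" "to_all (entails A (p b)) (q b) Y"
  obtains e where "below e b" "to_all (entails A (p e)) (q e) Y"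
proof -
  obtain i Z where "entails A (p b) (q b) i" "Z \<in> Con A i" "to_all (entails A (p b)) (q b) Z"
      "to_all (entails A i) Z Y"
    using interpolate assms codes_Con by metis
  then show thesis
    using that code_obtain[of Z i] by (metis below_def)
qed

text \<open>Codes are flattened to the tokens of \<open>A\<close> that their pairs mention. For
  finite \<open>F\<close>, interpolation in \<open>A\<close> thus becomes interpolation for
  \<open>below\<close>.\<close>

lemma all_below_iff:
  assumes "F \<subseteq> codes"
  shows "(\<forall>a\<in>F. below a b) \<longleftrightarrow> to_all (entails A (p b)) (q b) (\<Union>a\<in>F. insert (p a) (q a))"
  using assms by (auto simp: below_def)

lemma finite_codes: "finite F \<Longrightarrow> F \<subseteq> codes \<Longrightarrow> finite (\<Union>a\<in>F. insert (p a) (q a))"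
  using codes_finite by auto

lemma pair_Con_singleton: "b \<in> codes \<Longrightarrow> {b} \<in> pair_Con b"
  by (simp add: pair_Con_def)

lemma pair_Con_codes: "Z \<in> pair_Con b \<Longrightarrow> b \<in> codes"
  by (simp add: pair_Con_def)

text \<open>The axioms reduce to the definitions and the transitivity of \<open>below\<close>,
  except for interpolation, which is inherited from \<open>A\<close>.\<close>

lemma pair_frame: "continuous_information_frame pair_frame"
proof
  fix b Z Y
  assume "b \<in> tokens pair_frame" "Z \<in> Con pair_frame b" "finite Y" "Y \<subseteq> tokens pair_frame"
    "to_all (entails pair_frame b) Z Y"
  then have b: "b \<in> codes" "Y \<subseteq> codes" "\<forall>a\<in>Y. below a b"
    by auto
  then obtain e where e: "below e b" "\<forall>a\<in>Y. below a e"
    using below_interpolate[OF b(1) finite_codes[OF \<open>finite Y\<close> b(2)]] all_below_iff[OF b(2)]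
    by metis
  \<comment> \<open>\<open>{e}\<close> is consistent at \<open>e\<close>, and at index
    \<open>e\<close> it entails whatever lies below \<open>e\<close>.\<close>
  then show "\<exists>e\<in>tokens pair_frame. \<exists>W\<in>Con pair_frame e.
      to_all (entails pair_frame b) Z ({e} \<union> W) \<and> to_all (entails pair_frame e) W Y"
    using \<open>Z \<in> Con pair_frame b\<close> below_codes[OF e(1)] pair_Con_singleton
    by (intro bexI[of _ e] bexI[of _ "{e}"]) auto
qed (auto simp: acc_pair_frame pair_Con_def finite_subset intro: below_trans dest: below_codes)

lemma strong_pair_frame: "strong pair_frame"
  by (auto simp: strong_def pair_Con_def)

text \<open>\<open>{}\<close> entails \<open>t\<close> at every index, and weakening replaces
  \<open>{}\<close> by \<open>q c\<close>; so a code of the pair of \<open>t\<close> and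
  \<open>{}\<close> lies below every code \<open>c\<close>.\<close>

lemma pair_frame_truth:
  assumes "truth_element A t" "p b = t" "q b = {}"
  shows "truth_element pair_frame b"
proof -
  have "entails A (p c) (q c) t" if "c \<in> codes" for c
    using codes_Con[OF that] Con_tokens entails_weaken[of "p c" "{}" "q c" t] empty_Con assms(1)
    by (auto simp: truth_element_def)
  then show ?thesis
    using assms empty_Con by (auto simp: truth_element_def below_def codes_def pair_Con_def)
qed

lemma pair_frame_truth_ex:
  assumes "truth_element A t"
  obtains b where "p b = t" "q b = {}" "truth_element pair_frame b"
  using pair_frame_truth[OF assms] code_ex[of "{}" t] by auto

section \<open>Isomorphism of a frame with its frame of pairs\<close>

definition to_pair :: "'a \<Rightarrow> 'a set \<Rightarrow> 'b \<Rightarrow> bool" where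
  "to_pair i X b \<longleftrightarrow> b \<in> codes \<and> entails A i X (p b) \<and> to_all (entails A i) X (q b)"

text \<open>Like \<open>to_pair\<close>, this is the entailment of \<open>A\<close> seen through the
  coding. As in \<open>pair_frame\<close>, the information sits in the index
  \<open>b\<close>.\<close>

definition from_pair :: "'b \<Rightarrow> 'b set \<Rightarrow> 'a \<Rightarrow> bool" where
  "from_pair b Z a \<longleftrightarrow> Z \<in> pair_Con b \<and> entails A (p b) (q b) a"

lemma to_pair_code: "to_pair (p b) (q b) a \<longleftrightarrow> below a b"
  by (simp add: to_pair_def below_def)

lemma to_pair_below: "to_pair i X b \<Longrightarrow> below a b \<Longrightarrow> to_pair i X a"
  using to_all_entails_through[of i X "p b" "q b"] entails_through[of i X "p b" "q b"]
  by (auto simp: to_pair_def below_def)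

lemma to_pair_approximable: "approximable_family A pair_frame to_pair"
proof (intro approximable_family.intro approximable_family_axioms.intro)
  show "continuous_information_frame A" ..
  show "continuous_information_frame pair_frame" by (rule pair_frame)
next
  fix i X F
  assume X: "i \<in> tokens A" "X \<in> Con A i" and F: "finite F" "F \<subseteq> tokens pair_frame"
    "to_all (to_pair i) X F"
  \<comment> \<open>A code \<open>b\<close> of \<open>i\<close> and \<open>X\<close> turns the
    question into one about \<open>below\<close>. Two interpolations give \<open>F\<close> below
    \<open>e\<close>, \<open>e\<close> below \<open>d\<close> and \<open>d\<close> below
    \<open>b\<close>; decoding \<open>d\<close> yields the stage in \<open>A\<close>, and
    \<open>e\<close> with \<open>{e}\<close> is the stage in the frame of pairs.\<close>
  obtain b where b: "p b = i" "q b = X" "b \<in> codes"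
    using code_obtain X by blast
  have "\<forall>a\<in>F. below a b"
    using F(3) b to_pair_code[of b] by (simp add: to_all_def)
  then obtain e where e: "below e b" "\<forall>a\<in>F. below a e"
    using F b below_interpolate[OF b(3) finite_codes[of F]] all_below_iff[of F]
    by (metis pair_frame_simps(1))
  obtain d where d: "below d b" "below e d"
    using below_interpolate[OF b(3), of "insert (p e) (q e)"] e(1) below_codes[OF e(1)] codes_finite
    by (auto simp: below_def[of e])
  show "\<exists>c\<in>tokens A. \<exists>e\<in>tokens pair_frame. \<exists>U\<in>Con A c. \<exists>V\<in>Con pair_frame e.
      to_all (entails A i) X ({c} \<union> U) \<and> to_all (to_pair c) U ({e} \<union> V) \<and>
      to_all (entails pair_frame e) V F"
    using e d b below_codes[OF e(1)] below_codes[OF d(1)] pair_Con_singleton codes_Con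
      Con_tokens[of "q d" "p d"] to_pair_code[of d e]
    by (intro bexI[of _ "p d"] bexI[of _ e] bexI[of _ "q d"] bexI[of _ "{e}"])
      (auto simp: below_def[of d b])
next
  fix i j X b
  assume "i \<in> tokens A" "j \<in> tokens A" "acc A i j" "X \<in> Con A i" "to_pair i X b"
  then show "to_pair j X b"
    using entails_transfer by (auto simp: to_pair_def to_all_def)
next
  fix i X X' b
  assume "i \<in> tokens A" "X \<in> Con A i" "X' \<in> Con A i" "X \<subseteq> X'" "to_pair i X b"
  then show "to_pair i X' b"
    using entails_weaken[of i X X'] by (simp add: to_pair_def to_all_def)
next
  fix i X X' b
  assume "i \<in> tokens A" "X \<in> Con A i" "X' \<in> Con A i" "to_all (entails A i) X X'"
    "to_pair i X' b"
  then show "to_pair i X b"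
    using entails_cut[of i X X'] Con_tokens[of X' i]
    unfolding to_pair_def to_all_def[of _ _ "q b"] by blast
next
  fix i X k Y b
  assume "to_all (to_pair i) X ({k} \<union> Y)" "entails pair_frame k Y b"
  then show "to_pair i X b"
    using to_pair_below[of i X k b] by simp
qed (auto simp: to_pair_def dest: entails_tokens)

lemma from_pair_approximable: "approximable_family pair_frame A from_pair"
proof (intro approximable_family.intro approximable_family_axioms.intro)
  show "continuous_information_frame A" ..
  show "continuous_information_frame pair_frame" by (rule pair_frame)
next
  fix b Z F
  assume "b \<in> tokens pair_frame" "Z \<in> Con pair_frame b" "finite F" "to_all (from_pair b) Z F"
  then have b: "b \<in> codes" "to_all (entails A (p b)) (q b) F" "Z \<in> pair_Con b"
    by (auto simp: from_pair_def to_all_def)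
  \<comment> \<open>The two stages are in the opposite order here: \<open>c\<close> with
    \<open>{c}\<close> stays in the frame of pairs, and \<open>d\<close> below \<open>c\<close> is
    decoded into an index and a set of \<open>A\<close>.\<close>
  obtain c where c: "below c b" "to_all (entails A (p c)) (q c) F"
    using below_interpolate b \<open>finite F\<close> by blast
  then obtain d where d: "below d c" "to_all (entails A (p d)) (q d) F"
    using below_interpolate[of c] below_codes \<open>finite F\<close> by blast
  show "\<exists>c\<in>tokens pair_frame. \<exists>e\<in>tokens A. \<exists>U\<in>Con pair_frame c. \<exists>V\<in>Con A e.
      to_all (entails pair_frame b) Z ({c} \<union> U) \<and> to_all (from_pair c) U ({e} \<union> V) \<and>
      to_all (entails A e) V F"
    using c d b below_codes[OF c(1)] below_codes[OF d(1)] pair_Con_singleton codes_Con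
      Con_tokens[of "q d" "p d"]
    by (intro bexI[of _ c] bexI[of _ "p d"] bexI[of _ "{c}"] bexI[of _ "q d"])
      (auto simp: below_def[of d c] from_pair_def to_all_def)
next
  fix b c Z a
  assume "b \<in> tokens pair_frame" "c \<in> tokens pair_frame" "acc pair_frame b c"
    "Z \<in> Con pair_frame b" "from_pair b Z a"
  then show "from_pair c Z a"
    using continuous_information_frame.Con_transfer[OF pair_frame, of b c] below_entails[of b c]
    by (auto simp: from_pair_def acc_pair_frame)
next
  fix b Z k Y a
  assume "to_all (from_pair b) Z ({k} \<union> Y)" "entails A k Y a"
  then show "from_pair b Z a"
    using entails_through[of "p b" "q b" k Y a] by (simp add: from_pair_def to_all_def)
qed (auto simp: from_pair_def dest: pair_Con_codes entails_tokens)

text \<open>A chain through a pair collapses by \<open>entails_through\<close>; conversely,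
  interpolation below a code of \<open>i\<close> and \<open>X\<close> supplies the middle
  pair.\<close>

lemma to_from_pair: "family_comp pair_frame to_pair from_pair = entails A"
proof -
  have *: "composable A pair_frame A to_pair from_pair"
    using to_pair_approximable from_pair_approximable by (simp add: composable_def)
  show ?thesis
  proof (intro ext iffI)
    fix i X a
    assume "family_comp pair_frame to_pair from_pair i X a"
    then show "entails A i X a"
      using entails_through
      by (auto simp: composable.family_comp_iff[OF *] to_pair_def from_pair_def)
  next
    fix i X a
    assume a: "entails A i X a"
    then obtain b where b: "p b = i" "q b = X" "b \<in> codes"
      using code_obtain entails_tokens by metis
    then obtain e where e: "below e b" "entails A (p e) (q e) a"
      using a below_interpolate[of b "{a}"] by auto
    then have "to_pair i X e" "from_pair e {e} a"
      using b to_pair_code[of b e] below_codes pair_Con_singleton by (auto simp: from_pair_def)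
    then show "family_comp pair_frame to_pair from_pair i X a"
      unfolding composable.family_comp_iff[OF *]
      by (intro exI[of _ e] exI[of _ "{e}"]) simp
  qed
qed

text \<open>Here the middle stage lies in \<open>A\<close>: it is the decoding of a code
  \<open>e\<close> between \<open>a\<close> and \<open>b\<close>.\<close>

lemma from_to_pair: "family_comp A from_pair to_pair = entails pair_frame"
proof -
  have *: "composable pair_frame A pair_frame from_pair to_pair"
    using to_pair_approximable from_pair_approximable by (simp add: composable_def)
  show ?thesis
  proof (intro ext iffI)
    fix b Z a
    assume "family_comp A from_pair to_pair b Z a"
    then obtain e V where "from_pair b Z e" "to_all (from_pair b) Z V" "to_pair e V a"
      by (auto simp: composable.family_comp_iff[OF *])
    then show "entails pair_frame b Z a"
      using entails_through[of "p b" "q b" e V]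
      by (auto simp: to_pair_def from_pair_def below_def to_all_def)
  next
    fix b Z a
    assume a: "entails pair_frame b Z a"
    then obtain e where e: "below e b" "below a e"
      using below_interpolate[of b "insert (p a) (q a)"] below_codes[of a b] codes_finite
      by (auto simp: below_def[of a])
    then have "from_pair b Z (p e)" "to_all (from_pair b) Z (q e)" "to_pair (p e) (q e) a"
      using a by (auto simp: from_pair_def below_def[of e] to_all_def to_pair_code)
    then show "family_comp A from_pair to_pair b Z a"
      by (auto simp: composable.family_comp_iff[OF *])
  qed
qed

lemma to_pair_truth:
  assumes "truth_element A t"
  shows "respects_truth_elements A pair_frame to_pair"
proof -
  obtain b where "p b = t" "q b = {}" "truth_element pair_frame b"
    using pair_frame_truth_ex assms by blast
  then show ?thesis
    using assms respects_truth_elements_iff[OF to_pair_approximable assms, of b]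
    by (auto simp: truth_element_def to_pair_def)
qed

lemma from_pair_truth:
  assumes "truth_element A t"
  shows "respects_truth_elements pair_frame A from_pair"
proof -
  obtain b where "p b = t" "q b = {}" "truth_element pair_frame b"
    using pair_frame_truth_ex assms by blast
  then show ?thesis
    using assms respects_truth_elements_iff[OF from_pair_approximable, of b t]
    by (auto simp: truth_element_def from_pair_def)
qed

end

section \<open>Coding indices and finite sets in an infinite universe\<close>

lemma infinite_pair_coding:
  assumes "infinite (UNIV :: 'a set)"
  shows "\<exists>(p :: 'a \<Rightarrow> 'a) (q :: 'a \<Rightarrow> 'a set). \<forall>i X. finite X \<longrightarrow> (\<exists>b. p b = i \<and> q b = X)"
proof -
  have "|(UNIV :: 'a set) \<times> (UNIV :: 'a set)| =o |UNIV :: 'a set|"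
    using card_of_Times_same_infinite[OF assms] .
  then obtain c :: "'a \<times> 'a \<Rightarrow> 'a" where c: "inj c"
    using card_of_ordIso[of "(UNIV :: 'a set) \<times> (UNIV :: 'a set)" "UNIV :: 'a set"]
    by (auto simp: bij_betw_def)
  obtain n :: "nat \<Rightarrow> 'a" where n: "inj n"
    using infinite_countable_subset[OF assms] by blast
  \<comment> \<open>Lists are folded by nested pairing. As \<open>undefined\<close> may itself be
    the value of \<open>c\<close> at a pair, injectivity is guaranteed only between lists of equal
    length; hence \<open>e\<close> also records the length, through \<open>n\<close>.\<close>
  define k :: "'a list \<Rightarrow> 'a" where "k xs = foldr (\<lambda>x y. c (x, y)) xs undefined" for xs
  have k: "xs = ys" if "length xs = length ys" "k xs = k ys" for xs ys
    using that by (induction xs ys rule: list_induct2) (auto simp: k_def dest: injD[OF c])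
  define e where "e i xs = c (i, c (n (length xs), k xs))" for i xs
  have e: "i = j \<and> xs = ys" if "e i xs = e j ys" for i j xs ys
    using that k[of xs ys] by (auto simp: e_def dest!: injD[OF c] injD[OF n])
  \<comment> \<open>\<open>p\<close> and \<open>q\<close> decode a chosen preimage under
    \<open>e\<close>. Their values outside the range of \<open>e\<close> are arbitrary, which is
    harmless because only the existence of codes is claimed.\<close>
  define p where "p b = fst (SOME z. e (fst z) (snd z) = b)" for b
  define q where "q b = set (snd (SOME z. e (fst z) (snd z) = b))" for b
  have "(SOME z. e (fst z) (snd z) = e i xs) = (i, xs)" for i xs
    by (rule some_equality) (auto dest: e)
  then have "p (e i xs) = i \<and> q (e i xs) = set xs" for i xs
    by (simp add: p_def q_def)
  then have "\<forall>i X. finite X \<longrightarrow> (\<exists>b. p b = i \<and> q b = X)"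
    by (metis finite_list)
  then show ?thesis by blast
qed

theorem theorem5p10:
  assumes "infinite (UNIV :: 'a set)"
  shows "(full_subcategory (SIF_t :: ('a info_frame, 'a family) cat) CIF_t \<and>
          reflective_subcategory (SIF_t :: ('a info_frame, 'a family) cat) CIF_t) \<and>
         equivalent_categories
          (SIF_t :: ('a info_frame, 'a family) cat) (CIF_t :: ('a info_frame, 'a family) cat)"
proof -
  \<comment> \<open>One coding, chosen before any frame, serves all frames at once, so the
    replacement of \<open>A\<close> is a function of \<open>A\<close>.\<close>
  obtain p :: "'a \<Rightarrow> 'a" and q :: "'a \<Rightarrow> 'a set" where "\<And>i X. finite X \<Longrightarrow> \<exists>b. p b = i \<and> q b = X"
    using infinite_pair_coding[OF assms] by blast
  then have pc: "pair_coding A p q" if "continuous_information_frame A" for A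
    using that by (simp add: pair_coding_def pair_coding_axioms_def)
  have full: "full_subcategory (SIF_t :: ('a info_frame, 'a family) cat) CIF_t"
    by (intro category_full_sub category_CIF_t) (auto simp: SIF_t_def CIF_t_def)
  interpret category "CIF_t :: ('a info_frame, 'a family) cat"
    by (rule category_CIF_t)
  interpret isomorphic_replacement CIF_t SIF_t "\<lambda>A. pair_coding.pair_frame A p q"
    "\<lambda>A. pair_coding.to_pair A p q" "\<lambda>A. pair_coding.from_pair A p q"
  proof
    show "full_subcategory (SIF_t :: ('a info_frame, 'a family) cat) CIF_t" by fact
  next
    fix A :: "'a info_frame" assume "A \<in> obj CIF_t"
    then obtain t where A: "pair_coding A p q" and t: "truth_element A t"
      using pc by (auto simp: CIF_t_def)
    interpret pair_coding A p q by fact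
    show "pair_frame \<in> obj SIF_t"
      using pair_frame strong_pair_frame pair_frame_truth_ex[OF t] by (auto simp: SIF_t_def)
    show "to_pair \<in> hom CIF_t A pair_frame"
      using to_pair_approximable to_pair_truth t by (simp add: CIF_t_def)
    show "from_pair \<in> hom CIF_t pair_frame A"
      using from_pair_approximable from_pair_truth t by (simp add: CIF_t_def)
    show "cmp CIF_t A pair_frame A to_pair from_pair = ide CIF_t A"
      using to_from_pair by (simp add: CIF_t_def)
    show "cmp CIF_t pair_frame A pair_frame from_pair to_pair = ide CIF_t pair_frame"
      using from_to_pair by (simp add: CIF_t_def)
  qed
  show ?thesis
    using full reflective equivalent by blast
qed

end
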